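(* Every weakly thick $k$-uniform hypergraph $H$ satisfies Sidorenko's conjecture: $t(H,G)\ge t(e_k,G)^{|E(H)|}$ for every finite $k$-uniform hypergraph $G$.
   Context: A $k$-uniform hypergraph has a finite vertex set and edges that are $k$-element subsets. A homomorphism $H\to G$ is a map $V(H)\to V(G)$ sending every edge of $H$ onto an edge of $G$; $t(H,G)$ is the probability that a uniformly random map $V(H)\to V(G)$ is a homomorphism; $e_k$ is the hypergraph with a single edge $\{1,\dots,k\}$. $b$-hypergraphs: $M=(V,E,B)$ with $V$ finite, $E\subseteq 2^V$, $B\subseteq 2^V\times2^V$ symmetric. For $L\in E$, $X\subseteq L$: $r_{L,X}(M)$ has vertex set $V'$ = disjoint union of $V$ and $L$ with the two copies of each $x\in X$ identified (injections $\tau_1:V\to V'$, $\tau_2:L\to V'$); edges $\tau_1(K)$ ($K\in E$), $\tau_2(K)$ ($K\in E,K\subseteq L$), and $\tau_1(K_1)\cup\tau_2(K_2)$ for all $K_1,K_2\in E$ with $K_2\subseteq L$, $X\subseteq K_1\cap K_2$; relation: $\tau_1$-images of pairs in $B$, $\tau_2$-images of pairs in $B\cap(2^L\times2^L)$, and pairs $(\tau_1(K_1),\tau_2(K_2))$ (and reverses) for such $K_1,K_2$. A $k$-reflection complex is a $b$-hypergraph obtained from the trivial $k$-reflection complex $(\{1,\dots,k\},\{\{1,\dots,k\}\},\emptyset)$ by finitely many operations $r_{L,X}$ ($L$ an edge of the current $b$-hypergraph, $X\subseteq L$). Its frame $\mathcal{F}(M)$ is the $k$-uniform hypergraph on $V$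 whose edges are the members of $E$ of size $k$. Set functions: in $\mathbb{R}^{2^V}$, $1_S$ is the indicator of the subset $S$; $t_{A,B}=1_{A\cup B}-1_A-1_B+1_{A\cap B}$; $W_B=\mathrm{span}\{t_{A,B}:(A,B)\in B\}$; $Q_V=\mathbb{R}1_\emptyset+$ the cone of nonnegative combinations of all $t_{A,B}$ and $1_A$ ($A,B\subseteq V$). For a hypergraph $H$ on $V$, $s_H(V)=-1_V+\sum_{e\in E(H)}1_e$. A $k$-reflection complex $M=(V,E,B)$ with frame $H$ is weakly thick if $s_H(V)\in W_B+Q_V$; a $k$-uniform hypergraph is weakly thick if it is the frame of a weakly thick $k$-reflection complex. *)

theory Defs
  imports "HOL-Probability.Probability"
begin

record 'a hypergraph =
  verts :: "'a set"
  edges :: "'a set set"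

definition uniform_hypergraph :: "nat \<Rightarrow> 'a hypergraph \<Rightarrow> bool" where
  "uniform_hypergraph k H \<longleftrightarrow>
     finite (verts H) \<and> (\<forall>e\<in>edges H. e \<subseteq> verts H \<and> card e = k)"

definition hypergraph_iso :: "('a \<Rightarrow> 'b) \<Rightarrow> 'a hypergraph \<Rightarrow> 'b hypergraph \<Rightarrow> bool" where
  "hypergraph_iso f H H' \<longleftrightarrow>
     bij_betw f (verts H) (verts H') \<and> edges H' = (\<lambda>e. f ` e) ` edges H"

definition is_hom :: "'a hypergraph \<Rightarrow> 'b hypergraph \<Rightarrow> ('a \<Rightarrow> 'b) \<Rightarrow> bool" where
  "is_hom H G f \<longleftrightarrow> f \<in> verts H \<rightarrow>\<^sub>E verts G \<and> (\<forall>e\<in>edges H. f ` e \<in> edges G)"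

text \<open>Over finite vertex sets this is the number of homomorphisms divided by the number of maps;
  if there are no maps at all (\<open>verts G\<close> empty, \<open>verts H\<close> not) the value is \<open>0\<close>.\<close>
definition hom_density :: "'a hypergraph \<Rightarrow> 'b hypergraph \<Rightarrow> real" where
  "hom_density H G =
     measure (uniform_count_measure (verts H \<rightarrow>\<^sub>E verts G)) {f. is_hom H G f}"

definition single_edge :: "nat \<Rightarrow> nat hypergraph" where
  "single_edge k = \<lparr>verts = {1..k}, edges = {{1..k}}\<rparr>"


record 'a b_hypergraph = "'a hypergraph" +
  brel :: "('a set \<times> 'a set) set"

definition is_b_hypergraph :: "'a b_hypergraph \<Rightarrow> bool" where
  "is_b_hypergraph M \<longleftrightarrow>
     finite (verts M) \<and> edges M \<subseteq> Pow (verts M) \<and>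
     brel M \<subseteq> Pow (verts M) \<times> Pow (verts M) \<and> sym (brel M)"

text \<open>\<open>glues \<tau>\<^sub>1 \<tau>\<^sub>2 V L X\<close> says that \<open>\<tau>\<^sub>1 ` V \<union> \<tau>\<^sub>2 ` L\<close>, with \<open>\<tau>\<^sub>1\<close> and \<open>\<tau>\<^sub>2\<close> as the two injections, is a
  copy of the disjoint union of \<open>V\<close> and \<open>L\<close> in which exactly the two copies of each \<open>x \<in> X\<close> are
  identified. All choices of such a copy are admitted, so that the reflection is
  determined up to isomorphism.\<close>
definition glues :: "('a \<Rightarrow> 'b) \<Rightarrow> ('a \<Rightarrow> 'b) \<Rightarrow> 'a set \<Rightarrow> 'a set \<Rightarrow> 'a set \<Rightarrow> bool" where
  "glues \<tau>\<^sub>1 \<tau>\<^sub>2 V L X \<longleftrightarrow>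
     inj_on \<tau>\<^sub>1 V \<and> inj_on \<tau>\<^sub>2 L \<and> (\<forall>x\<in>V. \<forall>y\<in>L. \<tau>\<^sub>1 x = \<tau>\<^sub>2 y \<longleftrightarrow> x = y \<and> x \<in> X)"

definition reflection ::
  "('a \<Rightarrow> 'b) \<Rightarrow> ('a \<Rightarrow> 'b) \<Rightarrow> 'a set \<Rightarrow> 'a set \<Rightarrow> 'a b_hypergraph \<Rightarrow> 'b b_hypergraph" where
  "reflection \<tau>\<^sub>1 \<tau>\<^sub>2 L X M =
     \<lparr>verts = \<tau>\<^sub>1 ` verts M \<union> \<tau>\<^sub>2 ` L,
      edges = {\<tau>\<^sub>1 ` K | K. K \<in> edges M}
        \<union> {\<tau>\<^sub>2 ` K | K. K \<in> edges M \<and> K \<subseteq> L}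
        \<union> {\<tau>\<^sub>1 ` K\<^sub>1 \<union> \<tau>\<^sub>2 ` K\<^sub>2 | K\<^sub>1 K\<^sub>2.
             K\<^sub>1 \<in> edges M \<and> K\<^sub>2 \<in> edges M \<and> K\<^sub>2 \<subseteq> L \<and> X \<subseteq> K\<^sub>1 \<inter> K\<^sub>2},
      brel = {(\<tau>\<^sub>1 ` A, \<tau>\<^sub>1 ` B) | A B. (A, B) \<in> brel M}
        \<union> {(\<tau>\<^sub>2 ` A, \<tau>\<^sub>2 ` B) | A B. (A, B) \<in> brel M \<inter> (Pow L \<times> Pow L)}
        \<union> {(\<tau>\<^sub>1 ` K\<^sub>1, \<tau>\<^sub>2 ` K\<^sub>2) | K\<^sub>1 K\<^sub>2.
             K\<^sub>1 \<in> edges M \<and> K\<^sub>2 \<in> edges M \<and> K\<^sub>2 \<subseteq> L \<and> X \<subseteq> K\<^sub>1 \<inter> K\<^sub>2}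
        \<union> {(\<tau>\<^sub>2 ` K\<^sub>2, \<tau>\<^sub>1 ` K\<^sub>1) | K\<^sub>1 K\<^sub>2.
             K\<^sub>1 \<in> edges M \<and> K\<^sub>2 \<in> edges M \<and> K\<^sub>2 \<subseteq> L \<and> X \<subseteq> K\<^sub>1 \<inter> K\<^sub>2}\<rparr>"

text \<open>The vertices of reflection complexes are natural numbers; as these are finite structures, this
  loses nothing up to isomorphism.\<close>
inductive reflection_complex :: "nat \<Rightarrow> nat b_hypergraph \<Rightarrow> bool" for k :: nat where
  trivial: "reflection_complex k \<lparr>verts = {1..k}, edges = {{1..k}}, brel = {}\<rparr>"
| reflect: "reflection_complex k M \<Longrightarrow> L \<in> edges M \<Longrightarrow> X \<subseteq> L \<Longrightarrow> glues \<tau>\<^sub>1 \<tau>\<^sub>2 (verts M) L X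
    \<Longrightarrow> reflection_complex k (reflection \<tau>\<^sub>1 \<tau>\<^sub>2 L X M)"

definition frame :: "nat \<Rightarrow> 'a b_hypergraph \<Rightarrow> 'a hypergraph" where
  "frame k M = \<lparr>verts = verts M, edges = {K \<in> edges M. card K = k}\<rparr>"


text \<open>Elements of \<open>\<real>\<^bsup>2^V\<^esup>\<close> are represented as real functions on all sets; those occurring
  below vanish outside \<open>Pow V\<close>.\<close>
definition ind :: "'a set \<Rightarrow> 'a set \<Rightarrow> real" where
  "ind S = (\<lambda>T. if T = S then 1 else 0)"

definition t_fun :: "'a set \<Rightarrow> 'a set \<Rightarrow> 'a set \<Rightarrow> real" where
  "t_fun A B = (\<lambda>T. ind (A \<union> B) T - ind A T - ind B T + ind (A \<inter> B) T)"

text \<open>The linear span of \<open>{t_fun A B | (A, B) \<in> R}\<close>, written out because function types are not an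
  instance of \<open>real_vector\<close>.\<close>
definition W_space :: "('a set \<times> 'a set) set \<Rightarrow> ('a set \<Rightarrow> real) set" where
  "W_space R =
     {\<lambda>T. \<Sum>(A, B)\<in>F. c (A, B) * t_fun A B T | F c. finite F \<and> F \<subseteq> R}"

text \<open>\<open>V\<close> is meant to be finite.\<close>
definition Q_cone :: "'a set \<Rightarrow> ('a set \<Rightarrow> real) set" where
  "Q_cone V =
     {\<lambda>T. r * ind {} T + (\<Sum>(A, B)\<in>Pow V \<times> Pow V. a (A, B) * t_fun A B T)
            + (\<Sum>A\<in>Pow V. b A * ind A T) | r a b.
        (\<forall>p\<in>Pow V \<times> Pow V. 0 \<le> a p) \<and> (\<forall>A\<in>Pow V. 0 \<le> b A)}"

definition s_fun :: "'a hypergraph \<Rightarrow> 'a set \<Rightarrow> real" where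
  "s_fun H = (\<lambda>T. - ind (verts H) T + (\<Sum>e\<in>edges H. ind e T))"

definition weakly_thick_complex :: "nat \<Rightarrow> 'a b_hypergraph \<Rightarrow> bool" where
  "weakly_thick_complex k M \<longleftrightarrow>
     (\<exists>w\<in>W_space (brel M). \<exists>q\<in>Q_cone (verts M). s_fun (frame k M) = (\<lambda>T. w T + q T))"

definition weakly_thick :: "nat \<Rightarrow> 'a hypergraph \<Rightarrow> bool" where
  "weakly_thick k H \<longleftrightarrow>
     (\<exists>M f. reflection_complex k M \<and> weakly_thick_complex k M \<and> hypergraph_iso f (frame k M) H)"


lemma reflection_complex_is_b_hypergraph:
  assumes "reflection_complex k M"
  shows "is_b_hypergraph M"
  using assms
proof induction
  case trivial
  show ?case by (simp add: is_b_hypergraph_def sym_def)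
next
  case (reflect M L X \<tau>\<^sub>1 \<tau>\<^sub>2)
  let ?V = "\<tau>\<^sub>1 ` verts M \<union> \<tau>\<^sub>2 ` L"
  let ?M = "reflection \<tau>\<^sub>1 \<tau>\<^sub>2 L X M"
  have fin: "finite (verts M)" and E: "\<And>K. K \<in> edges M \<Longrightarrow> K \<subseteq> verts M"
    and B: "\<And>A B. (A, B) \<in> brel M \<Longrightarrow> A \<subseteq> verts M \<and> B \<subseteq> verts M"
    and s: "\<And>A B. (A, B) \<in> brel M \<Longrightarrow> (B, A) \<in> brel M"
    using reflect.IH by (auto simp: is_b_hypergraph_def sym_def)
  have V: "verts ?M = ?V" by (simp add: reflection_def)
  have i1: "\<tau>\<^sub>1 ` K \<subseteq> ?V" if "K \<subseteq> verts M" for K using that by blast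
  have i2: "\<tau>\<^sub>2 ` K \<subseteq> ?V" if "K \<subseteq> L" for K using that by blast
  have "P \<subseteq> ?V" if "P \<in> edges ?M" for P
    using that i1 i2 E unfolding reflection_def hypergraph.simps b_hypergraph.simps Un_iff mem_Collect_eq
    by (elim disjE exE conjE) (simp_all only: Un_least simp_thms)
  moreover have "P \<subseteq> ?V \<and> Q \<subseteq> ?V \<and> (Q, P) \<in> brel ?M" if PQ: "(P, Q) \<in> brel ?M" for P Q
  proof -
    consider (1) A B where "P = \<tau>\<^sub>1 ` A" "Q = \<tau>\<^sub>1 ` B" "(A, B) \<in> brel M"
      | (2) A B where "P = \<tau>\<^sub>2 ` A" "Q = \<tau>\<^sub>2 ` B" "(A, B) \<in> brel M" "A \<subseteq> L" "B \<subseteq> L"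
      | (3) K\<^sub>1 K\<^sub>2 where "P = \<tau>\<^sub>1 ` K\<^sub>1" "Q = \<tau>\<^sub>2 ` K\<^sub>2"
          "K\<^sub>1 \<in> edges M" "K\<^sub>2 \<in> edges M" "K\<^sub>2 \<subseteq> L" "X \<subseteq> K\<^sub>1 \<inter> K\<^sub>2"
      | (4) K\<^sub>1 K\<^sub>2 where "P = \<tau>\<^sub>2 ` K\<^sub>2" "Q = \<tau>\<^sub>1 ` K\<^sub>1"
          "K\<^sub>1 \<in> edges M" "K\<^sub>2 \<in> edges M" "K\<^sub>2 \<subseteq> L" "X \<subseteq> K\<^sub>1 \<inter> K\<^sub>2"
      using PQ[unfolded reflection_def b_hypergraph.simps] by blast
    then show ?thesis
    proof cases
      case 1
      then have "(Q, P) \<in> brel ?M" using s[OF 1(3)] unfolding reflection_def by (simp only: b_hypergraph.simps) blast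
      then show ?thesis using 1 B i1 by simp
    next
      case 2
      then have "(Q, P) \<in> brel ?M" using s[OF 2(3)] unfolding reflection_def by (simp only: b_hypergraph.simps) blast
      then show ?thesis using 2 i2 by simp
    next
      case 3
      then have "(Q, P) \<in> brel ?M" unfolding reflection_def by (simp only: b_hypergraph.simps) blast
      then show ?thesis using 3 E i1 i2 by simp
    next
      case 4
      then have "(Q, P) \<in> brel ?M" unfolding reflection_def by (simp only: b_hypergraph.simps) blast
      then show ?thesis using 4 E i1 i2 by simp
    qed
  qed
  moreover have "finite ?V"
    using fin E[OF reflect.hyps(2)] finite_subset by blast
  ultimately show ?case unfolding is_b_hypergraph_def sym_def V
    by (intro conjI subsetI) (simp, simp, clarify, blast, blast)
qed

lemma hom_density_eq_card:
  assumes "finite (verts H)" "finite (verts G)"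
  shows "hom_density H G
    = real (card {f. is_hom H G f}) / real (card (verts H \<rightarrow>\<^sub>E verts G))"
  unfolding hom_density_def
  by (rule measure_uniform_count_measure) (use assms in \<open>auto simp: is_hom_def intro: finite_PiE\<close>)

end

theory Submission
  imports Defs
begin

text \<open>
  Let \<open>n = card (verts G)\<close>. Starting from a uniformly random homomorphism \<open>e\<^sub>k \<rightarrow> G\<close>, each reflection
  \<open>r\<^bsub>L,X\<^esub>\<close> is followed by drawing the new copy of \<open>L\<close> conditionally independently given the values on
  \<open>X\<close>. The result is a random homomorphism \<open>\<mu>\<close> from the frame to \<open>G\<close> whose restriction to every
  \<open>k\<close>-edge is uniform and for which the values on \<open>A\<close> and \<open>B\<close> are conditionally independent given
  those on \<open>A \<inter> B\<close> whenever \<open>(A, B)\<close> belongs to the relation of the complex.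
  The relative entropy \<open>F S\<close> of the restriction of \<open>\<mu>\<close> to \<open>S\<close>, seen as a linear functional with
  \<open>F 1\<^sub>S = F S\<close>, is nonnegative on \<open>1\<^sub>A\<close> and, by strong subadditivity, on \<open>t\<^bsub>A,B\<^esub>\<close>, vanishes on \<open>1\<^sub>\<emptyset>\<close>,
  and by conditional independence vanishes on the space \<open>W\<^sub>B\<close>. Hence weak thickness gives
  \<open>F V \<le> (\<Sum>e. F e)\<close>, where \<open>F e = - ln (t(e\<^sub>k, G))\<close> and \<open>F V \<ge> - ln (t(H, G))\<close>.
\<close>

section \<open>Conditionally independent couplings\<close>

text \<open>The marginal of \<open>\<mu>\<close> on \<open>S\<close>, evaluated at the restriction
  of \<open>h\<close>. Total functions \<open>h\<close> serve as points of all marginals at once, in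
  place of restricted maps.\<close>

definition cyl :: "('a \<Rightarrow> 'b) pmf \<Rightarrow> 'a set \<Rightarrow> ('a \<Rightarrow> 'b) \<Rightarrow> real" where
  "cyl \<mu> S h = measure_pmf.prob \<mu> {f. \<forall>x\<in>S. f x = h x}"

lemma cyl_cong:
  assumes "\<And>x. x \<in> S \<Longrightarrow> g x = h x"
  shows "cyl \<mu> S g = cyl \<mu> S h"
  unfolding cyl_def using assms by (intro arg_cong2[where f = measure]) auto

lemma cyl_nonneg: "0 \<le> cyl \<mu> S h"
  by (simp add: cyl_def)

lemma cyl_antimono: "S \<subseteq> T \<Longrightarrow> cyl \<mu> T h \<le> cyl \<mu> S h"
  unfolding cyl_def by (rule measure_pmf.finite_measure_mono) auto

lemma cyl_pos: "f \<in> set_pmf \<mu> \<Longrightarrow> 0 < cyl \<mu> S f"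
  unfolding cyl_def by (rule measure_pmf_posI) auto

lemma cyl_empty [simp]: "cyl \<mu> {} h = 1"
  by (simp add: cyl_def)

lemma cyl_nonzeroD:
  assumes "cyl \<mu> S h \<noteq> 0"
  obtains f where "f \<in> set_pmf \<mu>" "\<And>x. x \<in> S \<Longrightarrow> f x = h x"
  using assms unfolding cyl_def
  by (auto simp: measure_pmf_zero_iff)

text \<open>Two copies of \<open>\<mu>\<close> that agree on \<open>X\<close> and are conditionally independent given their
  restriction to \<open>X\<close>.\<close>
definition coupling :: "('a \<Rightarrow> 'b) pmf \<Rightarrow> 'a set \<Rightarrow> (('a \<Rightarrow> 'b) \<times> ('a \<Rightarrow> 'b)) pmf" where
  "coupling \<mu> X = bind_pmf \<mu> (\<lambda>f. map_pmf (Pair f) (cond_pmf \<mu> {g. \<forall>x\<in>X. f x = g x}))"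

lemma agree_Int_nonempty: "f \<in> set_pmf \<mu> \<Longrightarrow> set_pmf \<mu> \<inter> {g. \<forall>x\<in>X. f x = g x} \<noteq> {}"
  by auto

lemma map_fst_coupling: "map_pmf fst (coupling \<mu> X) = \<mu>"
  by (simp add: coupling_def map_bind_pmf map_pmf_comp map_pmf_const bind_return_pmf')

text \<open>Agreement on \<open>X\<close> is an equivalence relation; redrawing a random point of
  \<open>\<mu>\<close> within its class gives \<open>\<mu>\<close> again, by the law of total
  probability.\<close>

lemma map_snd_coupling: "map_pmf snd (coupling \<mu> X) = \<mu>"
proof -
  have "bind_pmf \<mu> (\<lambda>f. cond_pmf \<mu> {g. \<forall>x\<in>X. f x = g x}) = \<mu>"
    by (rule bind_cond_pmf_cancel) (auto intro!: arg_cong2[where f = measure])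
  then show ?thesis
    by (simp add: coupling_def map_bind_pmf map_pmf_comp)
qed

lemma set_coupling:
  assumes "(f, g) \<in> set_pmf (coupling \<mu> X)"
  shows "f \<in> set_pmf \<mu>" "g \<in> set_pmf \<mu>" "\<And>x. x \<in> X \<Longrightarrow> f x = g x"
  using assms by (auto simp: coupling_def set_cond_pmf[OF agree_Int_nonempty])

lemma measure_cond_pmf:
  assumes "set_pmf p \<inter> S \<noteq> {}"
  shows "measure_pmf.prob (cond_pmf p S) A = measure_pmf.prob p (S \<inter> A) / measure_pmf.prob p S"
  unfolding cond_pmf.rep_eq[OF assms] 
  by (rule measure_uniform_measure)
     (use emeasure_measure_pmf_not_zero[OF assms] in \<open>auto simp: measure_pmf.emeasure_finite\<close>)

text \<open>Once the first copy agrees with \<open>f\<close> on \<open>A\<close>, its class under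
  agreement on \<open>X\<close> is that of \<open>f\<close>. As \<open>X \<subseteq> B\<close> and
  \<open>f\<close>, \<open>g\<close> agree on \<open>X\<close>, the event for the second copy lies
  inside this class, so its conditional probability is the constant
  \<open>cyl \<mu> B g / cyl \<mu> X f\<close>.\<close>

lemma prob_coupling:
  assumes "X \<subseteq> A" "X \<subseteq> B" "\<And>x. x \<in> X \<Longrightarrow> f x = g x"
  shows "measure_pmf.prob (coupling \<mu> X) ({f'. \<forall>x\<in>A. f' x = f x} \<times> {g'. \<forall>x\<in>B. g' x = g x})
    = cyl \<mu> A f * cyl \<mu> B g / cyl \<mu> X f" (is "measure_pmf.prob _ (?A \<times> ?B) = _")
proof -
  let ?c = "cyl \<mu> B g / cyl \<mu> X f"
  let ?C = "\<lambda>f'. map_pmf (Pair f') (cond_pmf \<mu> {g. \<forall>x\<in>X. f' x = g x})"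
  have "measure_pmf.prob (?C f') (?A \<times> ?B) = ?c * indicator ?A f'" if f': "f' \<in> set_pmf \<mu>" for f'
  proof (cases "f' \<in> ?A")
    case True
    then have X: "f' x = f x" "f' x = g x" if "x \<in> X" for x
      using assms that by (auto simp: subset_iff)
    have *: "{g. \<forall>x\<in>X. f' x = g x} \<inter> ?B = ?B"
      using X assms(2) by (auto simp: subset_iff)
    have **: "{g. \<forall>x\<in>X. f' x = g x} = {h. \<forall>x\<in>X. h x = f x}"
      using X(1) by auto
    show ?thesis
      using True by (simp add: vimage_def measure_cond_pmf[OF agree_Int_nonempty[OF f']] * cyl_def)
        (simp add: **)
  next
    case False
    then have "Pair f' -` (?A \<times> ?B) = {}" by auto
    then show ?thesis using False by (simp only: measure_map_pmf) simp
  qed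
  then have "emeasure (coupling \<mu> X) (?A \<times> ?B) = (\<integral>\<^sup>+f'. ennreal ?c * indicator ?A f' \<partial>\<mu>)"
    unfolding coupling_def emeasure_bind_pmf unfolding measure_pmf.emeasure_eq_measure
    by (intro nn_integral_cong_AE)
       (auto simp: AE_measure_pmf_iff cyl_nonneg split: split_indicator)
  also have "\<dots> = ennreal (?c * cyl \<mu> A f)"
    unfolding cyl_def[of \<mu> A]
    by (simp add: nn_integral_cmult measure_pmf.emeasure_eq_measure cyl_nonneg flip: ennreal_mult)
  finally show ?thesis
    by (simp add: measure_pmf.emeasure_eq_measure cyl_nonneg mult.commute)
qed

section \<open>Gluing two coupled maps along a reflection\<close>

text \<open>Where the two images overlap the first map wins, which is harmless for pairs agreeing on
  \<open>X\<close>. The default \<open>undefined\<close> keeps glued maps extensional.\<close>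

definition glue :: "('a \<Rightarrow> 'c) \<Rightarrow> ('a \<Rightarrow> 'c) \<Rightarrow> 'a set \<Rightarrow> 'a set
    \<Rightarrow> ('a \<Rightarrow> 'b) \<times> ('a \<Rightarrow> 'b) \<Rightarrow> 'c \<Rightarrow> 'b" where
  "glue \<tau>\<^sub>1 \<tau>\<^sub>2 V L = (\<lambda>(f, g) y. if y \<in> \<tau>\<^sub>1 ` V then f (inv_into V \<tau>\<^sub>1 y)
     else if y \<in> \<tau>\<^sub>2 ` L then g (inv_into L \<tau>\<^sub>2 y) else undefined)"

definition reflect_pmf :: "('a \<Rightarrow> 'c) \<Rightarrow> ('a \<Rightarrow> 'c) \<Rightarrow> 'a set \<Rightarrow> 'a set \<Rightarrow> 'a set
    \<Rightarrow> ('a \<Rightarrow> 'b) pmf \<Rightarrow> ('c \<Rightarrow> 'b) pmf" where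
  "reflect_pmf \<tau>\<^sub>1 \<tau>\<^sub>2 V L X \<mu> = map_pmf (glue \<tau>\<^sub>1 \<tau>\<^sub>2 V L) (coupling \<mu> X)"

context
  fixes \<tau>\<^sub>1 \<tau>\<^sub>2 :: "'a \<Rightarrow> 'c" and V L X :: "'a set"
  assumes glues: "glues \<tau>\<^sub>1 \<tau>\<^sub>2 V L X" and XL: "X \<subseteq> L" and LV: "L \<subseteq> V"
begin

lemma glue_left: "x \<in> V \<Longrightarrow> glue \<tau>\<^sub>1 \<tau>\<^sub>2 V L (f, g) (\<tau>\<^sub>1 x) = f x"
  using glues by (auto simp: glue_def glues_def)

lemma glues_eq_iff: "x \<in> V \<Longrightarrow> y \<in> L \<Longrightarrow> \<tau>\<^sub>1 x = \<tau>\<^sub>2 y \<longleftrightarrow> x = y \<and> x \<in> X"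
  using glues by (auto simp: glues_def)

lemma glue_right:
  assumes "\<And>x. x \<in> X \<Longrightarrow> f x = g x" "x \<in> L"
  shows "glue \<tau>\<^sub>1 \<tau>\<^sub>2 V L (f, g) (\<tau>\<^sub>2 x) = g x"
proof (cases "\<tau>\<^sub>2 x \<in> \<tau>\<^sub>1 ` V")
  case True
  then obtain y where y: "y \<in> V" "\<tau>\<^sub>2 x = \<tau>\<^sub>1 y" by auto
  then have "y = x" "x \<in> X"
    using glues_eq_iff[of y x] assms(2) by auto
  then show ?thesis
    using y assms(1) glue_left[of y f g] by simp
next
  case False
  then show ?thesis
    using glues assms by (auto simp: glue_def glues_def)
qed

text \<open>The two coupled maps almost surely agree on \<open>X\<close>, so both can be read off
  from the glued map. A cylinder event of the glued map is therefore a product event up to a null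
  set.\<close>

lemma cyl_reflect_prob:
  assumes "K\<^sub>1 \<subseteq> V" "K\<^sub>2 \<subseteq> L"
  shows "cyl (reflect_pmf \<tau>\<^sub>1 \<tau>\<^sub>2 V L X \<mu>) (\<tau>\<^sub>1 ` K\<^sub>1 \<union> \<tau>\<^sub>2 ` K\<^sub>2) h
    = measure_pmf.prob (coupling \<mu> X)
        ({f. \<forall>x\<in>K\<^sub>1. f x = (h \<circ> \<tau>\<^sub>1) x} \<times> {g. \<forall>x\<in>K\<^sub>2. g x = (h \<circ> \<tau>\<^sub>2) x})"
  unfolding cyl_def reflect_pmf_def measure_map_pmf
proof (rule measure_pmf.finite_measure_eq_AE)
  have l: "glue \<tau>\<^sub>1 \<tau>\<^sub>2 V L (f, g) (\<tau>\<^sub>1 x) = f x" if "x \<in> K\<^sub>1" for f g :: "'a \<Rightarrow> 'd" and x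
    using glue_left assms(1) that by blast
  have r: "glue \<tau>\<^sub>1 \<tau>\<^sub>2 V L (f, g) (\<tau>\<^sub>2 x) = g x" if "x \<in> K\<^sub>2" "(f, g) \<in> set_pmf (coupling \<mu> X)"
    for f g x
    using set_coupling(3)[OF that(2)] that(1) assms(2) by (intro glue_right) auto
  show "AE p in coupling \<mu> X. p \<in> glue \<tau>\<^sub>1 \<tau>\<^sub>2 V L -` {f. \<forall>x\<in>\<tau>\<^sub>1 ` K\<^sub>1 \<union> \<tau>\<^sub>2 ` K\<^sub>2. f x = h x}
    \<longleftrightarrow> p \<in> {f. \<forall>x\<in>K\<^sub>1. f x = (h \<circ> \<tau>\<^sub>1) x} \<times> {g. \<forall>x\<in>K\<^sub>2. g x = (h \<circ> \<tau>\<^sub>2) x}"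
    by (auto simp: AE_measure_pmf_iff l r ball_Un)
qed auto

lemma cyl_reflect_left:
  assumes "K \<subseteq> V"
  shows "cyl (reflect_pmf \<tau>\<^sub>1 \<tau>\<^sub>2 V L X \<mu>) (\<tau>\<^sub>1 ` K) h = cyl \<mu> K (h \<circ> \<tau>\<^sub>1)"
proof -
  have "cyl \<mu> K (h \<circ> \<tau>\<^sub>1) = cyl (map_pmf fst (coupling \<mu> X)) K (h \<circ> \<tau>\<^sub>1)"
    by (simp add: map_fst_coupling)
  \<comment> \<open>With one of the two edges empty, the product event constrains a single copy,
    whose law is \<open>\<mu>\<close>.\<close>
  also have "\<dots> = cyl (reflect_pmf \<tau>\<^sub>1 \<tau>\<^sub>2 V L X \<mu>) (\<tau>\<^sub>1 ` K \<union> \<tau>\<^sub>2 ` {}) h"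
    unfolding cyl_reflect_prob[OF assms empty_subsetI] unfolding cyl_def measure_map_pmf
    by (intro arg_cong2[where f = measure]) auto
  finally show ?thesis by simp
qed

lemma cyl_reflect_right:
  assumes "K \<subseteq> L"
  shows "cyl (reflect_pmf \<tau>\<^sub>1 \<tau>\<^sub>2 V L X \<mu>) (\<tau>\<^sub>2 ` K) h = cyl \<mu> K (h \<circ> \<tau>\<^sub>2)"
proof -
  have "cyl \<mu> K (h \<circ> \<tau>\<^sub>2) = cyl (map_pmf snd (coupling \<mu> X)) K (h \<circ> \<tau>\<^sub>2)"
    by (simp add: map_snd_coupling)
  also have "\<dots> = cyl (reflect_pmf \<tau>\<^sub>1 \<tau>\<^sub>2 V L X \<mu>) (\<tau>\<^sub>1 ` {} \<union> \<tau>\<^sub>2 ` K) h"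
    unfolding cyl_reflect_prob[OF empty_subsetI assms] unfolding cyl_def measure_map_pmf
    by (intro arg_cong2[where f = measure]) auto
  finally show ?thesis by simp
qed

text \<open>Points of the two copies coincide only over \<open>X\<close>, and \<open>X\<close> lies
  in both sets.\<close>

lemma glued_image_Int:
  assumes "K\<^sub>1 \<subseteq> V" "K\<^sub>2 \<subseteq> L" "X \<subseteq> K\<^sub>1 \<inter> K\<^sub>2"
  shows "\<tau>\<^sub>1 ` K\<^sub>1 \<inter> \<tau>\<^sub>2 ` K\<^sub>2 = \<tau>\<^sub>1 ` X"
proof -
  note g = glues_eq_iff
  show ?thesis
  proof (intro equalityI subsetI)
    fix z assume "z \<in> \<tau>\<^sub>1 ` K\<^sub>1 \<inter> \<tau>\<^sub>2 ` K\<^sub>2"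
    then obtain x y where "x \<in> K\<^sub>1" "y \<in> K\<^sub>2" "z = \<tau>\<^sub>1 x" "\<tau>\<^sub>1 x = \<tau>\<^sub>2 y" by auto
    then show "z \<in> \<tau>\<^sub>1 ` X" using g[of x y] assms by blast
  next
    fix z assume "z \<in> \<tau>\<^sub>1 ` X"
    then obtain x where x: "x \<in> X" "z = \<tau>\<^sub>1 x" by auto
    then have "\<tau>\<^sub>1 x = \<tau>\<^sub>2 x" using g[of x x] XL LV by blast
    then show "z \<in> \<tau>\<^sub>1 ` K\<^sub>1 \<inter> \<tau>\<^sub>2 ` K\<^sub>2" using x assms(3) by blast
  qed
qed

text \<open>The factor for the intersection cancels the denominator \<open>cyl \<mu> X\<close> of
  the product formula for the coupling.\<close>

lemma cyl_reflect_cond_indep: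
  fixes \<mu> :: "('a \<Rightarrow> 'b) pmf"
  assumes "K\<^sub>1 \<subseteq> V" "K\<^sub>2 \<subseteq> L" "X \<subseteq> K\<^sub>1 \<inter> K\<^sub>2"
  defines "\<nu> \<equiv> reflect_pmf \<tau>\<^sub>1 \<tau>\<^sub>2 V L X \<mu>"
  shows "cyl \<nu> (\<tau>\<^sub>1 ` K\<^sub>1 \<union> \<tau>\<^sub>2 ` K\<^sub>2) h * cyl \<nu> (\<tau>\<^sub>1 ` K\<^sub>1 \<inter> \<tau>\<^sub>2 ` K\<^sub>2) h
    = cyl \<nu> (\<tau>\<^sub>1 ` K\<^sub>1) h * cyl \<nu> (\<tau>\<^sub>2 ` K\<^sub>2) h"
proof -
  have "(h \<circ> \<tau>\<^sub>1) x = (h \<circ> \<tau>\<^sub>2) x" if "x \<in> X" for x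
    using glues_eq_iff[of x x] that XL LV by (simp add: subset_iff)
  then have "cyl \<nu> (\<tau>\<^sub>1 ` K\<^sub>1 \<union> \<tau>\<^sub>2 ` K\<^sub>2) h
      = cyl \<mu> K\<^sub>1 (h \<circ> \<tau>\<^sub>1) * cyl \<mu> K\<^sub>2 (h \<circ> \<tau>\<^sub>2) / cyl \<mu> X (h \<circ> \<tau>\<^sub>1)"
    unfolding \<nu>_def cyl_reflect_prob[OF assms(1,2)] using assms(3) by (intro prob_coupling) auto
  moreover have "cyl \<nu> (\<tau>\<^sub>1 ` K\<^sub>1 \<inter> \<tau>\<^sub>2 ` K\<^sub>2) h = cyl \<mu> X (h \<circ> \<tau>\<^sub>1)"
    unfolding glued_image_Int[OF assms(1-3)] \<nu>_def using XL LV by (intro cyl_reflect_left) auto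
  \<comment> \<open>If \<open>cyl \<mu> X\<close> is zero, the cancellation fails, but then the
    factor for \<open>K\<^sub>1\<close> is zero too and both sides vanish.\<close>
  moreover have "cyl \<mu> K\<^sub>1 (h \<circ> \<tau>\<^sub>1) \<le> cyl \<mu> X (h \<circ> \<tau>\<^sub>1)"
    using assms(3) by (intro cyl_antimono) auto
  ultimately show ?thesis
    using cyl_nonneg[of \<mu> K\<^sub>1 "h \<circ> \<tau>\<^sub>1"]
    by (auto simp: \<nu>_def cyl_reflect_left[OF assms(1)] cyl_reflect_right[OF assms(2)])
qed

lemma set_reflect_pmf:
  assumes "set_pmf \<mu> \<subseteq> V \<rightarrow>\<^sub>E W"
  shows "set_pmf (reflect_pmf \<tau>\<^sub>1 \<tau>\<^sub>2 V L X \<mu>) \<subseteq> (\<tau>\<^sub>1 ` V \<union> \<tau>\<^sub>2 ` L) \<rightarrow>\<^sub>E W"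
proof -
  have "glue \<tau>\<^sub>1 \<tau>\<^sub>2 V L (f, g) \<in> (\<tau>\<^sub>1 ` V \<union> \<tau>\<^sub>2 ` L) \<rightarrow>\<^sub>E W"
    if fg: "(f, g) \<in> set_pmf (coupling \<mu> X)" for f g
  proof -
    have f_g: "f \<in> V \<rightarrow>\<^sub>E W" "g \<in> V \<rightarrow>\<^sub>E W"
      using set_coupling(1,2)[OF fg] assms by auto
    show ?thesis
    proof (rule PiE_I)
      fix y assume "y \<in> \<tau>\<^sub>1 ` V \<union> \<tau>\<^sub>2 ` L"
      then show "glue \<tau>\<^sub>1 \<tau>\<^sub>2 V L (f, g) y \<in> W"
        using f_g LV set_coupling(3)[OF fg] by (auto simp: glue_left glue_right)
    qed (simp add: glue_def)
  qed
  then show ?thesis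
    unfolding reflect_pmf_def set_map_pmf by (intro image_subsetI) (metis surj_pair)
qed

end

section \<open>Relative entropy of marginals\<close>

text \<open>Group the support by restriction to \<open>S\<close>: the fibre over \<open>g\<close>
  has mass \<open>cyl \<mu> S g\<close>, which cancels the denominator. This bounds an expectation
  under \<open>\<mu>\<close> by a plain sum over maps on \<open>S\<close>.\<close>

lemma sum_fibres_cyl_le:
  assumes \<mu>: "set_pmf \<mu> \<subseteq> V \<rightarrow>\<^sub>E W" and fin: "finite V" "finite W" and S: "S \<subseteq> V"
    and \<psi>: "\<And>f. 0 \<le> \<psi> f" "\<And>f g. (\<And>x. x \<in> S \<Longrightarrow> f x = g x) \<Longrightarrow> \<psi> f = \<psi> g"
  shows "(\<Sum>f\<in>set_pmf \<mu>. pmf \<mu> f * (\<psi> f / cyl \<mu> S f)) \<le> (\<Sum>g\<in>S \<rightarrow>\<^sub>E W. \<psi> g)"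
proof -
  have finS: "finite (S \<rightarrow>\<^sub>E W)"
    using fin S finite_subset by (intro finite_PiE) auto
  have fin\<mu>: "finite (set_pmf \<mu>)"
    using \<mu> fin by (rule finite_subset[OF _ finite_PiE])
  have "(\<Sum>f\<in>set_pmf \<mu>. pmf \<mu> f * (\<psi> f / cyl \<mu> S f))
      = (\<Sum>g\<in>S \<rightarrow>\<^sub>E W. \<Sum>f\<in>{f \<in> set_pmf \<mu>. restrict f S = g}. pmf \<mu> f * (\<psi> f / cyl \<mu> S f))"
    using \<mu> S by (intro sum.group[symmetric] fin\<mu> finS) (auto simp: subset_iff PiE_iff)
  also have "\<dots> \<le> (\<Sum>g\<in>S \<rightarrow>\<^sub>E W. \<psi> g)"
  proof (rule sum_mono)
    fix g assume g: "g \<in> S \<rightarrow>\<^sub>E W"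
    let ?F = "{f \<in> set_pmf \<mu>. restrict f S = g}"
    have F: "?F = set_pmf \<mu> \<inter> {f. \<forall>x\<in>S. f x = g x}"
      using g by (auto simp: PiE_iff fun_eq_iff extensional_def)
    have "(\<Sum>f\<in>?F. pmf \<mu> f * (\<psi> f / cyl \<mu> S f)) = (\<Sum>f\<in>?F. pmf \<mu> f * (\<psi> g / cyl \<mu> S g))"
    proof (rule sum.cong)
      fix f assume "f \<in> ?F"
      then have "f x = g x" if "x \<in> S" for x
        using that F by auto
      then show "pmf \<mu> f * (\<psi> f / cyl \<mu> S f) = pmf \<mu> f * (\<psi> g / cyl \<mu> S g)"
        using \<psi>(2)[of f g] cyl_cong[of S f g \<mu>] by simp
    qed simp
    also have "\<dots> = measure_pmf.prob \<mu> ?F * (\<psi> g / cyl \<mu> S g)"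
      using fin\<mu> by (simp add: measure_measure_pmf_finite sum_distrib_right sum_divide_distrib)
    also have "measure_pmf.prob \<mu> ?F = cyl \<mu> S g"
      unfolding F cyl_def by (subst Int_commute) (rule measure_Int_set_pmf)
    \<comment> \<open>Strict inequality can occur only when \<open>cyl \<mu> S g = 0\<close>, where
      the division yields zero.\<close>
    also have "cyl \<mu> S g * (\<psi> g / cyl \<mu> S g) \<le> \<psi> g"
      using \<psi>(1)[of g] by simp
    finally show "(\<Sum>f\<in>?F. pmf \<mu> f * (\<psi> f / cyl \<mu> S f)) \<le> \<psi> g" .
  qed
  finally show ?thesis .
qed

text \<open>Gibbs' inequality, by averaging \<open>1 - 1 / u \<le> ln u\<close>. All entropy
  estimates below are instances with different \<open>u\<close>.\<close>

lemma expectation_ln_ge: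
  assumes "finite (set_pmf \<mu>)" "\<And>f. f \<in> set_pmf \<mu> \<Longrightarrow> 0 < u f"
    and "(\<Sum>f\<in>set_pmf \<mu>. pmf \<mu> f * (1 / u f)) \<le> 1"
  shows "0 \<le> (\<Sum>f\<in>set_pmf \<mu>. pmf \<mu> f * ln (u f :: real))"
proof -
  have "0 \<le> (\<Sum>f\<in>set_pmf \<mu>. pmf \<mu> f) - (\<Sum>f\<in>set_pmf \<mu>. pmf \<mu> f * (1 / u f))"
    using assms by (simp add: sum_pmf_eq_1)
  also have "\<dots> = (\<Sum>f\<in>set_pmf \<mu>. pmf \<mu> f * (1 - 1 / u f))"
    by (simp add: sum_subtractf[symmetric] algebra_simps)
  also have "\<dots> \<le> (\<Sum>f\<in>set_pmf \<mu>. pmf \<mu> f * ln (u f))"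
  proof (intro sum_mono mult_left_mono pmf_nonneg)
    fix f assume "f \<in> set_pmf \<mu>"
    then show "1 - 1 / u f \<le> ln (u f)"
      using assms(2)[of f] ln_le_minus_one[of "1 / u f"] by (simp add: ln_div)
  qed
  finally show ?thesis .
qed

text \<open>Each summand is the probability, under the coupling over \<open>A \<inter> B\<close>,
  that the first copy matches \<open>g\<close> on \<open>A\<close> and the second on
  \<open>B\<close>. These events are disjoint for distinct \<open>g\<close>.\<close>

lemma sum_cond_indep_le_1:
  assumes "finite A" "finite B" "finite W"
  shows "(\<Sum>g\<in>(A \<union> B) \<rightarrow>\<^sub>E W. cyl \<mu> A g * cyl \<mu> B g / cyl \<mu> (A \<inter> B) g) \<le> 1"
proof -
  let ?P = "measure_pmf.prob (coupling \<mu> (A \<inter> B))"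
  let ?S = "\<lambda>g. {f. \<forall>x\<in>A. f x = g x} \<times> {f. \<forall>x\<in>B. f x = g x}"
  have fin: "finite ((A \<union> B) \<rightarrow>\<^sub>E W)"
    using assms by (intro finite_PiE) auto
  have disj: "disjoint_family_on ?S ((A \<union> B) \<rightarrow>\<^sub>E W)"
    unfolding disjoint_family_on_def
  proof (intro ballI impI)
    fix g h assume gh: "g \<in> (A \<union> B) \<rightarrow>\<^sub>E W" "h \<in> (A \<union> B) \<rightarrow>\<^sub>E W" "g \<noteq> h"
    show "?S g \<inter> ?S h = {}"
    proof (rule ccontr)
      assume "?S g \<inter> ?S h \<noteq> {}"
      then have "g x = h x" if "x \<in> A \<union> B" for x
        using that by auto
      then show False
        using gh PiE_ext by metis
    qed
  qed
  have "(\<Sum>g\<in>(A \<union> B) \<rightarrow>\<^sub>E W. cyl \<mu> A g * cyl \<mu> B g / cyl \<mu> (A \<inter> B) g)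
      = (\<Sum>g\<in>(A \<union> B) \<rightarrow>\<^sub>E W. ?P (?S g))"
    by (intro sum.cong refl prob_coupling[symmetric]) auto
  also have "\<dots> = ?P (\<Union>g\<in>(A \<union> B) \<rightarrow>\<^sub>E W. ?S g)"
    using fin disj by (intro measure_pmf.finite_measure_finite_Union[symmetric]) auto
  also have "\<dots> \<le> 1"
    by simp
  finally show ?thesis .
qed

text \<open>The relative entropy, with respect to the uniform distribution on \<open>S \<rightarrow> W\<close> with \<open>n = card W\<close>,
  of the restriction of \<open>\<mu>\<close> to \<open>S\<close>.\<close>
definition rel_entropy :: "nat \<Rightarrow> ('a \<Rightarrow> 'b) pmf \<Rightarrow> 'a set \<Rightarrow> real" where
  "rel_entropy n \<mu> S = (\<Sum>f\<in>set_pmf \<mu>. pmf \<mu> f * ln (real n ^ card S * cyl \<mu> S f))"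

context
  fixes \<mu> :: "('a \<Rightarrow> 'b) pmf" and V :: "'a set" and W :: "'b set" and n :: nat
  assumes \<mu>: "set_pmf \<mu> \<subseteq> V \<rightarrow>\<^sub>E W" and fin: "finite V" "finite W" and n: "n = card W"
begin

lemma finite_support: "finite (set_pmf \<mu>)"
  using \<mu> fin by (rule finite_subset[OF _ finite_PiE])

lemma card_functions:
  assumes "S \<subseteq> V"
  shows "real (card (S \<rightarrow>\<^sub>E W)) = real n ^ card S"
  using assms fin finite_subset by (subst card_funcsetE) (auto simp: n)

text \<open>Positivity comes from the existence of a map \<open>S \<rightarrow> W\<close>, because
  \<open>n\<close> itself may be zero when \<open>V\<close> is empty.\<close>

lemma n_power_pos:
  assumes "S \<subseteq> V"
  shows "0 < real n ^ card S"
proof -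
  obtain f where "f \<in> set_pmf \<mu>" using set_pmf_not_empty by fastforce
  then have "restrict f S \<in> S \<rightarrow>\<^sub>E W" using \<mu> assms by (auto simp: subset_iff PiE_iff)
  moreover have "finite (S \<rightarrow>\<^sub>E W)"
    using fin assms finite_subset by (intro finite_PiE) auto
  ultimately show ?thesis
    unfolding card_functions[OF assms, symmetric] by (simp only: of_nat_0_less_iff card_gt_0_iff) blast
qed

text \<open>Here \<open>u\<close> is the ratio of the marginal on \<open>S\<close> to the uniform
  density, and the uniform density sums to one.\<close>

lemma rel_entropy_nonneg:
  assumes "S \<subseteq> V"
  shows "0 \<le> rel_entropy n \<mu> S"
  unfolding rel_entropy_def
proof (rule expectation_ln_ge[OF finite_support])
  show "0 < real n ^ card S * cyl \<mu> S f" if "f \<in> set_pmf \<mu>" for f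
    using that by (intro mult_pos_pos n_power_pos[OF assms] cyl_pos)
  have "(\<Sum>f\<in>set_pmf \<mu>. pmf \<mu> f * (1 / real n ^ card S / cyl \<mu> S f))
      \<le> (\<Sum>g\<in>S \<rightarrow>\<^sub>E W. 1 / real n ^ card S)"
    by (rule sum_fibres_cyl_le[OF \<mu> fin assms]) auto
  also have "\<dots> = 1"
    using n_power_pos[OF assms] by (simp add: card_functions[OF assms])
  finally show "(\<Sum>f\<in>set_pmf \<mu>. pmf \<mu> f * (1 / (real n ^ card S * cyl \<mu> S f))) \<le> 1"
    by simp
qed

lemma rel_entropy_empty [simp]: "rel_entropy n \<mu> {} = 0"
  by (simp add: rel_entropy_def)

text \<open>The right-hand side is the conditional mutual information of \<open>A\<close> and
  \<open>B\<close> given \<open>A \<inter> B\<close>, an expected logarithm to which Gibbs'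
  inequality applies.\<close>

lemma rel_entropy_t_fun:
  assumes "A \<subseteq> V" "B \<subseteq> V"
  shows "rel_entropy n \<mu> (A \<union> B) - rel_entropy n \<mu> A - rel_entropy n \<mu> B + rel_entropy n \<mu> (A \<inter> B)
    = (\<Sum>f\<in>set_pmf \<mu>. pmf \<mu> f * ln (cyl \<mu> (A \<union> B) f * cyl \<mu> (A \<inter> B) f / (cyl \<mu> A f * cyl \<mu> B f)))"
proof -
  have c: "card (A \<union> B) + card (A \<inter> B) = card A + card B"
    using assms fin card_Un_Int finite_subset by metis
  have V: "A \<union> B \<subseteq> V" "A \<inter> B \<subseteq> V"
    using assms by auto
  have "real n ^ card (A \<union> B) * real n ^ card (A \<inter> B) = real n ^ card A * real n ^ card B"
    by (simp only: power_add[symmetric] c)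
  then have w: "ln (real n ^ card (A \<union> B)) + ln (real n ^ card (A \<inter> B))
      = ln (real n ^ card A) + ln (real n ^ card B)"
    by (simp only: ln_mult_pos[symmetric] n_power_pos assms V)
  have "ln (real n ^ card (A \<union> B) * cyl \<mu> (A \<union> B) f) - ln (real n ^ card A * cyl \<mu> A f)
        - ln (real n ^ card B * cyl \<mu> B f) + ln (real n ^ card (A \<inter> B) * cyl \<mu> (A \<inter> B) f)
      = ln (cyl \<mu> (A \<union> B) f * cyl \<mu> (A \<inter> B) f / (cyl \<mu> A f * cyl \<mu> B f))"
    if f: "f \<in> set_pmf \<mu>" for f
  proof -
    have l: "ln (real n ^ card S * cyl \<mu> S f) = ln (real n ^ card S) + ln (cyl \<mu> S f)" if "S \<subseteq> V" for S
      by (rule ln_mult_pos[OF n_power_pos[OF that] cyl_pos[OF f]])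
    have "ln (cyl \<mu> (A \<union> B) f * cyl \<mu> (A \<inter> B) f / (cyl \<mu> A f * cyl \<mu> B f))
        = ln (cyl \<mu> (A \<union> B) f) + ln (cyl \<mu> (A \<inter> B) f) - (ln (cyl \<mu> A f) + ln (cyl \<mu> B f))"
      by (simp only: ln_divide_pos ln_mult_pos mult_pos_pos cyl_pos[OF f])
    then show ?thesis
      using w l[OF V(1)] l[OF V(2)] l[OF assms(1)] l[OF assms(2)] by linarith
  qed
  then show ?thesis
    unfolding rel_entropy_def sum_subtractf[symmetric] sum.distrib[symmetric]
    by (intro sum.cong) (auto simp flip: right_diff_distrib distrib_left)
qed

text \<open>This is strong subadditivity of Shannon entropy; the sizes cancel because \<open>card\<close> is modular.\<close>
lemma rel_entropy_supermodular:
  assumes "A \<subseteq> V" "B \<subseteq> V"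
  shows "0 \<le> rel_entropy n \<mu> (A \<union> B) - rel_entropy n \<mu> A - rel_entropy n \<mu> B + rel_entropy n \<mu> (A \<inter> B)"
  unfolding rel_entropy_t_fun[OF assms]
proof (rule expectation_ln_ge[OF finite_support])
  show "0 < cyl \<mu> (A \<union> B) f * cyl \<mu> (A \<inter> B) f / (cyl \<mu> A f * cyl \<mu> B f)"
    if "f \<in> set_pmf \<mu>" for f
    using cyl_pos[OF that] by simp
  \<comment> \<open>The density that the marginals on \<open>A\<close> and \<open>B\<close> would
    have jointly if they were conditionally independent given \<open>A \<inter> B\<close>; the
    marginal on \<open>A \<union> B\<close> is compared with it.\<close>
  let ?\<psi> = "\<lambda>f. cyl \<mu> A f * cyl \<mu> B f / cyl \<mu> (A \<inter> B) f"
  have "(\<Sum>f\<in>set_pmf \<mu>. pmf \<mu> f * (?\<psi> f / cyl \<mu> (A \<union> B) f)) \<le> (\<Sum>g\<in>(A \<union> B) \<rightarrow>\<^sub>E W. ?\<psi> g)"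
  proof (rule sum_fibres_cyl_le[OF \<mu> fin])
    fix f g :: "'a \<Rightarrow> 'b" assume "\<And>x. x \<in> A \<union> B \<Longrightarrow> f x = g x"
    then show "?\<psi> f = ?\<psi> g"
      using cyl_cong[of A f g \<mu>] cyl_cong[of B f g \<mu>] cyl_cong[of "A \<inter> B" f g \<mu>] by simp
  qed (use assms in \<open>auto intro!: divide_nonneg_nonneg mult_nonneg_nonneg cyl_nonneg\<close>)
  also have "\<dots> \<le> 1"
    using assms fin finite_subset by (intro sum_cond_indep_le_1) auto
  finally show "(\<Sum>f\<in>set_pmf \<mu>. pmf \<mu> f
      * (1 / (cyl \<mu> (A \<union> B) f * cyl \<mu> (A \<inter> B) f / (cyl \<mu> A f * cyl \<mu> B f)))) \<le> 1"
    by (simp add: mult.commute)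
qed

lemma rel_entropy_cond_indep:
  assumes "A \<subseteq> V" "B \<subseteq> V"
    and "\<And>f. cyl \<mu> (A \<union> B) f * cyl \<mu> (A \<inter> B) f = cyl \<mu> A f * cyl \<mu> B f"
  shows "rel_entropy n \<mu> (A \<union> B) - rel_entropy n \<mu> A - rel_entropy n \<mu> B + rel_entropy n \<mu> (A \<inter> B) = 0"
  unfolding rel_entropy_t_fun[OF assms(1,2)] assms(3) by (auto intro!: sum.neutral)

text \<open>The logarithm is constant on the support. This evaluates the entropy on the edges of the
  frame.\<close>

lemma rel_entropy_uniform:
  assumes "\<And>f. f \<in> set_pmf \<mu> \<Longrightarrow> cyl \<mu> S f = c"
  shows "rel_entropy n \<mu> S = ln (real n ^ card S * c)"
proof -
  have "rel_entropy n \<mu> S = (\<Sum>f\<in>set_pmf \<mu>. pmf \<mu> f) * ln (real n ^ card S * c)"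
    unfolding rel_entropy_def sum_distrib_right using assms by (intro sum.cong) auto
  then show ?thesis
    using finite_support by (simp add: sum_pmf_eq_1)
qed

text \<open>Shannon entropy is at most the logarithm of the size of a set containing the support.
  With \<open>S\<close> the set of homomorphisms, this brings in their number.\<close>

lemma rel_entropy_support_ge:
  assumes "set_pmf \<mu> \<subseteq> S" "finite S"
  shows "ln (real n ^ card V / real (card S)) \<le> rel_entropy n \<mu> V"
proof -
  \<comment> \<open>Maps in the support are extensional on \<open>V\<close>, so each is determined
    by its values there.\<close>
  have cyl: "cyl \<mu> V f = pmf \<mu> f" if f: "f \<in> set_pmf \<mu>" for f
  proof -
    have "g = f" if "g \<in> set_pmf \<mu>" "\<forall>x\<in>V. g x = f x" for g
      using PiE_ext[of g V "\<lambda>_. W" f] \<mu> f that by blast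
    then have "set_pmf \<mu> \<inter> {g. \<forall>x\<in>V. g x = f x} = {f}"
      using f by auto
    then show ?thesis
      unfolding cyl_def
      by (subst measure_Int_set_pmf[symmetric], subst Int_commute) (simp add: measure_pmf_single)
  qed
  have S: "0 < real (card S)"
    using assms set_pmf_not_empty[of \<mu>] by (auto simp: card_gt_0_iff)
  have n: "0 < real n ^ card V"
    by (rule n_power_pos) simp
  have "0 \<le> (\<Sum>f\<in>set_pmf \<mu>. pmf \<mu> f * ln (real (card S) * pmf \<mu> f))"
  proof (rule expectation_ln_ge[OF finite_support])
    have "(\<Sum>f\<in>set_pmf \<mu>. pmf \<mu> f * (1 / (real (card S) * pmf \<mu> f)))
        = (\<Sum>f\<in>set_pmf \<mu>. 1 / real (card S))"
      by (intro sum.cong) (auto simp: set_pmf_iff)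
    also have "\<dots> \<le> 1"
      using card_mono[OF assms(2,1)] S by simp
    finally show "(\<Sum>f\<in>set_pmf \<mu>. pmf \<mu> f * (1 / (real (card S) * pmf \<mu> f))) \<le> 1" .
  qed (use S in \<open>auto simp: pmf_positive\<close>)
  also have "\<dots> = (\<Sum>f\<in>set_pmf \<mu>. pmf \<mu> f * ln (real n ^ card V * cyl \<mu> V f)
      - pmf \<mu> f * ln (real n ^ card V / real (card S)))"
  proof (rule sum.cong)
    fix f assume f: "f \<in> set_pmf \<mu>"
    then have "ln (real (card S) * pmf \<mu> f)
        = ln (real n ^ card V * cyl \<mu> V f) - ln (real n ^ card V / real (card S))"
      using S n pmf_positive[OF f] by (simp add: cyl ln_mult ln_div)
    then show "pmf \<mu> f * ln (real (card S) * pmf \<mu> f) = pmf \<mu> f * ln (real n ^ card V * cyl \<mu> V f)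
        - pmf \<mu> f * ln (real n ^ card V / real (card S))"
      by (simp add: right_diff_distrib)
  qed simp
  also have "\<dots> = rel_entropy n \<mu> V - ln (real n ^ card V / real (card S))"
    using finite_support
    by (simp only: sum_subtractf rel_entropy_def sum_distrib_right[symmetric] sum_pmf_eq_1 mult_1_left)
  finally show ?thesis by simp
qed

end

section \<open>The entropy inequality from weak thickness\<close>

text \<open>Extend \<open>F\<close> to a linear functional \<open>\<phi>\<close> on set functions.
  It vanishes on \<open>W_space\<close> and is nonnegative on \<open>Q_cone\<close>, hence
  nonnegative at \<open>s_fun\<close>, where its value is the edge sum minus
  \<open>F (verts M)\<close>.\<close>

lemma weakly_thick_complex_le:
  fixes F :: "'a set \<Rightarrow> real"
  assumes M: "is_b_hypergraph M" and thick: "weakly_thick_complex k M"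
    and empty: "F {} = 0"
    and nonneg: "\<And>A. A \<subseteq> verts M \<Longrightarrow> 0 \<le> F A"
    and super: "\<And>A B. A \<subseteq> verts M \<Longrightarrow> B \<subseteq> verts M \<Longrightarrow> 0 \<le> F (A \<union> B) - F A - F B + F (A \<inter> B)"
    and modular: "\<And>A B. (A, B) \<in> brel M \<Longrightarrow> F (A \<union> B) - F A - F B + F (A \<inter> B) = 0"
  shows "F (verts M) \<le> (\<Sum>e\<in>edges (frame k M). F e)"
proof -
  let ?V = "verts M"
  have fin: "finite ?V" and E: "edges M \<subseteq> Pow ?V" and B: "brel M \<subseteq> Pow ?V \<times> Pow ?V"
    using M by (auto simp: is_b_hypergraph_def)
  define \<phi> where "\<phi> u = (\<Sum>T\<in>Pow ?V. u T * F T)" for u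
  have ind: "\<phi> (ind S) = F S" if "S \<subseteq> ?V" for S
  proof -
    have "\<phi> (ind S) = (\<Sum>T\<in>Pow ?V. if T = S then F T else 0)"
      unfolding \<phi>_def ind_def by (intro sum.cong) auto
    then show ?thesis using that fin by simp
  qed
  have add: "\<phi> (\<lambda>T. u T + v T) = \<phi> u + \<phi> v" for u v
    by (simp add: \<phi>_def sum.distrib distrib_right)
  have diff: "\<phi> (\<lambda>T. u T - v T) = \<phi> u - \<phi> v" for u v
    by (simp add: \<phi>_def sum_subtractf left_diff_distrib)
  have neg: "\<phi> (\<lambda>T. - u T) = - \<phi> u" for u
    by (simp add: \<phi>_def sum_negf)
  have scale: "\<phi> (\<lambda>T. c * u T) = c * \<phi> u" for c u
    by (simp add: \<phi>_def sum_distrib_left mult.assoc)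
  have sum: "\<phi> (\<lambda>T. \<Sum>i\<in>I. u i T) = (\<Sum>i\<in>I. \<phi> (u i))" for I :: "'i set" and u
    unfolding \<phi>_def sum_distrib_right by (rule sum.swap)
  have t: "\<phi> (t_fun A B) = F (A \<union> B) - F A - F B + F (A \<inter> B)" if "A \<subseteq> ?V" "B \<subseteq> ?V" for A B
    unfolding t_fun_def add diff using that by (simp add: ind le_infI1)
  obtain w q where w: "w \<in> W_space (brel M)" and q: "q \<in> Q_cone ?V"
    and s: "s_fun (frame k M) = (\<lambda>T. w T + q T)"
    using thick by (auto simp: weakly_thick_complex_def)
  have "\<phi> w = 0"
  proof -
    obtain R c where w_eq: "w = (\<lambda>T. \<Sum>(A, B)\<in>R. c (A, B) * t_fun A B T)" and R: "R \<subseteq> brel M"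
      using w by (auto simp: W_space_def)
    have "\<phi> w = (\<Sum>(A, B)\<in>R. c (A, B) * \<phi> (t_fun A B))"
      unfolding w_eq case_prod_beta sum scale ..
    also have "\<dots> = 0"
    proof (intro sum.neutral ballI)
      fix p assume "p \<in> R"
      then obtain A B where p: "p = (A, B)" and AB: "(A, B) \<in> brel M"
        using R by (cases p) auto
      then have "\<phi> (t_fun A B) = 0"
        using t[of A B] modular[OF AB] B by auto
      then show "(case p of (A, B) \<Rightarrow> c (A, B) * \<phi> (t_fun A B)) = 0"
        by (simp add: p)
    qed
    finally show ?thesis .
  qed
  moreover have "0 \<le> \<phi> q"
  proof -
    obtain r a b where q_eq: "q = (\<lambda>T. r * ind {} T
        + (\<Sum>(A, B)\<in>Pow ?V \<times> Pow ?V. a (A, B) * t_fun A B T) + (\<Sum>A\<in>Pow ?V. b A * ind A T))"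
      and a: "\<forall>p\<in>Pow ?V \<times> Pow ?V. 0 \<le> a p" and b: "\<forall>A\<in>Pow ?V. 0 \<le> b A"
      using q unfolding Q_cone_def by blast
    \<comment> \<open>The term with \<open>r\<close>, whose sign is arbitrary, disappears because
      \<open>F {} = 0\<close>.\<close>
    have "\<phi> q = (\<Sum>(A, B)\<in>Pow ?V \<times> Pow ?V. a (A, B) * \<phi> (t_fun A B)) + (\<Sum>A\<in>Pow ?V. b A * \<phi> (ind A))"
      unfolding q_eq case_prod_beta add sum scale by (simp add: ind empty)
    also have "\<dots> \<ge> 0"
    proof (intro add_nonneg_nonneg sum_nonneg)
      fix p assume "p \<in> Pow ?V \<times> Pow ?V"
      then show "0 \<le> (case p of (A, B) \<Rightarrow> a (A, B) * \<phi> (t_fun A B))"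
        using a super t by auto
    next
      fix A assume "A \<in> Pow ?V"
      then show "0 \<le> b A * \<phi> (ind A)"
        using b nonneg ind by auto
    qed
    finally show ?thesis .
  qed
  moreover have "\<phi> (s_fun (frame k M)) = \<phi> w + \<phi> q"
    unfolding s add ..
  moreover have "\<phi> (s_fun (frame k M)) = - F ?V + (\<Sum>e\<in>edges (frame k M). F e)"
  proof -
    have "(\<Sum>e\<in>edges (frame k M). \<phi> (ind e)) = (\<Sum>e\<in>edges (frame k M). F e)"
      using E by (intro sum.cong) (auto simp: frame_def ind)
    then show ?thesis
      unfolding s_fun_def add neg sum by (simp add: frame_def ind)
  qed
  ultimately show ?thesis by linarith
qed

section \<open>Random homomorphisms from reflection complexes\<close>

lemma reflection_edgeE:
  assumes "K \<in> edges (reflection \<tau>\<^sub>1 \<tau>\<^sub>2 L X M)"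
  obtains (left) K\<^sub>1 where "K\<^sub>1 \<in> edges M" "K = \<tau>\<^sub>1 ` K\<^sub>1"
    | (right) K\<^sub>2 where "K\<^sub>2 \<in> edges M" "K\<^sub>2 \<subseteq> L" "K = \<tau>\<^sub>2 ` K\<^sub>2"
    | (both) K\<^sub>1 K\<^sub>2 where "K\<^sub>1 \<in> edges M" "K\<^sub>2 \<in> edges M" "K\<^sub>2 \<subseteq> L" "X \<subseteq> K\<^sub>1 \<inter> K\<^sub>2"
        "K = \<tau>\<^sub>1 ` K\<^sub>1 \<union> \<tau>\<^sub>2 ` K\<^sub>2"
  using assms unfolding reflection_def hypergraph.simps b_hypergraph.simps
  by (elim UnE CollectE exE conjE) (simp_all only: that)

lemma reflection_brelE:
  assumes "(P, Q) \<in> brel (reflection \<tau>\<^sub>1 \<tau>\<^sub>2 L X M)"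
  obtains (left) A B where "(A, B) \<in> brel M" "P = \<tau>\<^sub>1 ` A" "Q = \<tau>\<^sub>1 ` B"
    | (right) A B where "(A, B) \<in> brel M" "A \<subseteq> L" "B \<subseteq> L" "P = \<tau>\<^sub>2 ` A" "Q = \<tau>\<^sub>2 ` B"
    | (both) K\<^sub>1 K\<^sub>2 where "K\<^sub>1 \<in> edges M" "K\<^sub>2 \<in> edges M" "K\<^sub>2 \<subseteq> L" "X \<subseteq> K\<^sub>1 \<inter> K\<^sub>2"
        "P = \<tau>\<^sub>1 ` K\<^sub>1" "Q = \<tau>\<^sub>2 ` K\<^sub>2"
    | (both') K\<^sub>1 K\<^sub>2 where "K\<^sub>1 \<in> edges M" "K\<^sub>2 \<in> edges M" "K\<^sub>2 \<subseteq> L" "X \<subseteq> K\<^sub>1 \<inter> K\<^sub>2"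
        "P = \<tau>\<^sub>2 ` K\<^sub>2" "Q = \<tau>\<^sub>1 ` K\<^sub>1"
  using assms unfolding reflection_def b_hypergraph.simps
  by (elim UnE CollectE exE conjE IntE SigmaE2) (simp_all only: that prod.inject Pow_iff)

text \<open>Every new edge contains an injective image of an old one. Consequently a union edge of
  size \<open>k\<close> adds nothing to the image of its first part.\<close>

lemma reflection_complex_card_ge:
  assumes "reflection_complex k M" "K \<in> edges M"
  shows "k \<le> card K"
  using assms
proof (induction arbitrary: K)
  case trivial
  then show ?case by simp
next
  case (reflect M L X \<tau>\<^sub>1 \<tau>\<^sub>2)
  have sub: "K \<subseteq> verts M" "finite K" if "K \<in> edges M" for K
    using reflection_complex_is_b_hypergraph[OF reflect.hyps(1)] that finite_subset
    by (auto simp: is_b_hypergraph_def)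
  have inj: "inj_on \<tau>\<^sub>1 (verts M)" "inj_on \<tau>\<^sub>2 L"
    using reflect.hyps(4) by (auto simp: glues_def)
  have card: "card (\<tau>\<^sub>1 ` K) = card K" if "K \<in> edges M" for K
    using card_image[OF inj_on_subset[OF inj(1) sub(1)[OF that]]] .
  show ?case
    using reflect.prems
  proof (cases rule: reflection_edgeE)
    case (left K\<^sub>1)
    then show ?thesis using reflect.IH card by simp
  next
    case (right K\<^sub>2)
    then show ?thesis using reflect.IH card_image[OF inj_on_subset[OF inj(2)]] by simp
  next
    case (both K\<^sub>1 K\<^sub>2)
    have "k \<le> card (\<tau>\<^sub>1 ` K\<^sub>1)"
      using both reflect.IH card by simp
    also have "\<dots> \<le> card K"
      unfolding both(5) using both sub by (intro card_mono) auto
    finally show ?thesis .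
  qed
qed

text \<open>An edge of size \<open>k\<close> survives in the first copy. A positive exponent makes
  the density bound trivial when \<open>e_k\<close> has no homomorphism to \<open>G\<close>.\<close>

lemma reflection_complex_frame_nonempty:
  assumes "reflection_complex k M"
  shows "edges (frame k M) \<noteq> {}"
  using assms
proof induction
  case trivial
  show ?case by (simp add: frame_def)
next
  case (reflect M L X \<tau>\<^sub>1 \<tau>\<^sub>2)
  then obtain K where K: "K \<in> edges M" "card K = k"
    by (auto simp: frame_def)
  have "K \<subseteq> verts M"
    using reflection_complex_is_b_hypergraph[OF reflect.hyps(1)] K by (auto simp: is_b_hypergraph_def)
  moreover have "inj_on \<tau>\<^sub>1 (verts M)"
    using reflect.hyps(4) by (simp add: glues_def)
  ultimately have "card (\<tau>\<^sub>1 ` K) = k"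
    using K card_image inj_on_subset by metis
  then show ?case
    using K(1) by (auto simp: frame_def reflection_def)
qed

lemma finite_homs:
  assumes "finite (verts H)" "finite (verts G)"
  shows "finite {f. is_hom H G f}"
  by (rule finite_subset[OF _ finite_PiE[of "verts H" "\<lambda>_. verts G"]]) (use assms in \<open>auto simp: is_hom_def\<close>)

text \<open>Induction along the reflections, starting from a uniform homomorphism of the single
  edge. The marginal condition is stated for every \<open>h\<close> of nonzero probability, so that
  it passes through \<open>h \<circ> \<tau>\<^sub>1\<close> and
  \<open>h \<circ> \<tau>\<^sub>2\<close>.\<close>

lemma reflection_complex_pmf:
  fixes G :: "'b hypergraph"
  assumes M: "reflection_complex k M" and G: "finite (verts G)"
    and homs: "{f. is_hom (single_edge k) G f} \<noteq> {}"
  shows "\<exists>\<mu>. set_pmf \<mu> \<subseteq> verts M \<rightarrow>\<^sub>E verts G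
    \<and> (\<forall>K h. K \<in> edges (frame k M) \<longrightarrow> cyl \<mu> K h \<noteq> 0 \<longrightarrow>
          cyl \<mu> K h = 1 / real (card {f. is_hom (single_edge k) G f}) \<and> h ` K \<in> edges G)
    \<and> (\<forall>A B h. (A, B) \<in> brel M \<longrightarrow>
          cyl \<mu> (A \<union> B) h * cyl \<mu> (A \<inter> B) h = cyl \<mu> A h * cyl \<mu> B h)"
  using M
proof induction
  case trivial
  let ?S = "{f. is_hom (single_edge k) G f}"
  let ?\<mu> = "pmf_of_set ?S"
  have fin: "finite ?S"
    using G by (intro finite_homs) (simp_all add: single_edge_def)
  have S: "set_pmf ?\<mu> = ?S"
    using fin homs by simp
  have "cyl ?\<mu> {1..k} h = 1 / real (card ?S) \<and> h ` {1..k} \<in> edges G"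
    if "cyl ?\<mu> {1..k} h \<noteq> 0" for h
  proof -
    from that obtain f where f: "f \<in> set_pmf ?\<mu>" and fh: "\<And>x. x \<in> {1..k} \<Longrightarrow> f x = h x"
      by (rule cyl_nonzeroD) blast
    have "g = f" if "g \<in> ?S" "\<forall>x\<in>{1..k}. g x = h x" for g
      using that f fh unfolding S
      by (intro PiE_ext[of g "{1..k}" "\<lambda>_. verts G" f]) (simp_all add: is_hom_def single_edge_def)
    then have "?S \<inter> {g. \<forall>x\<in>{1..k}. g x = h x} = {f}"
      using f fh unfolding S by blast
    then have "cyl ?\<mu> {1..k} h = 1 / real (card ?S)"
      unfolding cyl_def measure_pmf_of_set[OF homs fin] by simp
    moreover have "h ` {1..k} = f ` {1..k}"
      using fh by (intro image_cong) auto
    ultimately show ?thesis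
      using f unfolding S by (simp add: is_hom_def single_edge_def)
  qed
  moreover have "set_pmf ?\<mu> \<subseteq> {1..k} \<rightarrow>\<^sub>E verts G"
    unfolding S by (simp add: is_hom_def single_edge_def subset_iff)
  ultimately show ?case
    by (intro exI[of _ ?\<mu>]) (auto simp: frame_def)
next
  case (reflect M L X \<tau>\<^sub>1 \<tau>\<^sub>2)
  let ?V = "verts M" and ?N = "real (card {f. is_hom (single_edge k) G f})"
  let ?M' = "reflection \<tau>\<^sub>1 \<tau>\<^sub>2 L X M"
  obtain \<mu> where \<mu>: "set_pmf \<mu> \<subseteq> ?V \<rightarrow>\<^sub>E verts G"
    and marg: "\<And>K h. K \<in> edges M \<Longrightarrow> card K = k \<Longrightarrow> cyl \<mu> K h \<noteq> 0 \<Longrightarrow>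
      cyl \<mu> K h = 1 / ?N \<and> h ` K \<in> edges G"
    and indep: "\<And>A B h. (A, B) \<in> brel M \<Longrightarrow>
      cyl \<mu> (A \<union> B) h * cyl \<mu> (A \<inter> B) h = cyl \<mu> A h * cyl \<mu> B h"
    using reflect.IH unfolding frame_def by auto
  have V: "finite ?V" and E: "\<And>K. K \<in> edges M \<Longrightarrow> K \<subseteq> ?V"
    and B: "\<And>A B. (A, B) \<in> brel M \<Longrightarrow> A \<subseteq> ?V \<and> B \<subseteq> ?V"
    using reflection_complex_is_b_hypergraph[OF reflect.hyps(1)]
    by (auto simp: is_b_hypergraph_def)
  have LV: "L \<subseteq> ?V"
    using E reflect.hyps(2) .
  have inj: "inj_on \<tau>\<^sub>1 ?V" "inj_on \<tau>\<^sub>2 L"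
    using reflect.hyps(4) by (auto simp: glues_def)
  note glues = reflect.hyps(4,3) LV
  define \<nu> where "\<nu> = reflect_pmf \<tau>\<^sub>1 \<tau>\<^sub>2 ?V L X \<mu>"
  have l: "cyl \<nu> (\<tau>\<^sub>1 ` K) h = cyl \<mu> K (h \<circ> \<tau>\<^sub>1)" if "K \<subseteq> ?V" for K h
    unfolding \<nu>_def by (rule cyl_reflect_left[OF glues that])
  have r: "cyl \<nu> (\<tau>\<^sub>2 ` K) h = cyl \<mu> K (h \<circ> \<tau>\<^sub>2)" if "K \<subseteq> L" for K h
    unfolding \<nu>_def by (rule cyl_reflect_right[OF glues that])
  have glued: "cyl \<nu> (\<tau>\<^sub>1 ` K\<^sub>1 \<union> \<tau>\<^sub>2 ` K\<^sub>2) h * cyl \<nu> (\<tau>\<^sub>1 ` K\<^sub>1 \<inter> \<tau>\<^sub>2 ` K\<^sub>2) h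
      = cyl \<nu> (\<tau>\<^sub>1 ` K\<^sub>1) h * cyl \<nu> (\<tau>\<^sub>2 ` K\<^sub>2) h"
    if "K\<^sub>1 \<in> edges M" "K\<^sub>2 \<subseteq> L" "X \<subseteq> K\<^sub>1 \<inter> K\<^sub>2" for K\<^sub>1 K\<^sub>2 h
    unfolding \<nu>_def using that by (intro cyl_reflect_cond_indep[OF glues] E)
  have "cyl \<nu> K h = 1 / ?N \<and> h ` K \<in> edges G"
    if K: "K \<in> edges ?M'" "card K = k" and nz: "cyl \<nu> K h \<noteq> 0" for K h
  proof -
    have from_left: ?thesis if K1: "K\<^sub>1 \<in> edges M" "K = \<tau>\<^sub>1 ` K\<^sub>1" for K\<^sub>1
    proof -
      have "card K\<^sub>1 = k"
        using K(2) K1 card_image[OF inj_on_subset[OF inj(1) E]] by simp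
      then show ?thesis
        using marg[of K\<^sub>1 "h \<circ> \<tau>\<^sub>1"] nz K1 E l by (simp add: image_comp)
    qed
    show ?thesis
      using K(1)
    proof (cases rule: reflection_edgeE)
      case left
      then show ?thesis using from_left by blast
    next
      case (right K\<^sub>2)
      have "card K\<^sub>2 = k"
        using K(2) right card_image[OF inj_on_subset[OF inj(2)]] by simp
      then show ?thesis
        using marg[of K\<^sub>2 "h \<circ> \<tau>\<^sub>2"] nz right r by (simp add: image_comp)
    next
      case (both K\<^sub>1 K\<^sub>2)
      \<comment> \<open>A union edge of size \<open>k\<close> contains the first image, of size at
        least \<open>k\<close>, and so equals it; the left case then applies.\<close>
      have "k \<le> card (\<tau>\<^sub>1 ` K\<^sub>1)"
        using reflection_complex_card_ge[OF reflect.hyps(1)] both(1)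
          card_image[OF inj_on_subset[OF inj(1) E]] by simp
      moreover have "finite K"
        using both V LV E finite_subset by (metis finite_UnI finite_imageI)
      ultimately have "K = \<tau>\<^sub>1 ` K\<^sub>1"
        using card_seteq[of K "\<tau>\<^sub>1 ` K\<^sub>1"] both(5) K(2) by auto
      then show ?thesis using from_left both(1) by blast
    qed
  qed
  moreover have "cyl \<nu> (P \<union> Q) h * cyl \<nu> (P \<inter> Q) h = cyl \<nu> P h * cyl \<nu> Q h"
    if "(P, Q) \<in> brel ?M'" for P Q h
    using that
  proof (cases rule: reflection_brelE)
    case (left A C)
    \<comment> \<open>The old relation transfers because an injective image commutes with
      intersections.\<close>
    then have "A \<subseteq> ?V" "C \<subseteq> ?V" "A \<union> C \<subseteq> ?V" "A \<inter> C \<subseteq> ?V"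
      using B by auto
    then show ?thesis
      using left indep[of A C "h \<circ> \<tau>\<^sub>1"]
      by (simp add: l image_Un[symmetric] inj_on_image_Int[OF inj(1), symmetric])
  next
    case (right A C)
    then have "A \<union> C \<subseteq> L" "A \<inter> C \<subseteq> L"
      by auto
    then show ?thesis
      using right indep[of A C "h \<circ> \<tau>\<^sub>2"]
      by (simp add: r image_Un[symmetric] inj_on_image_Int[OF inj(2), symmetric])
  next
    case (both K\<^sub>1 K\<^sub>2)
    then show ?thesis using glued by simp
  next
    case (both' K\<^sub>1 K\<^sub>2)
    then show ?thesis using glued[of K\<^sub>1 K\<^sub>2 h] by (simp add: Un_commute Int_commute mult.commute)
  qed
  moreover have "set_pmf \<nu> \<subseteq> verts ?M' \<rightarrow>\<^sub>E verts G"
    unfolding \<nu>_def using set_reflect_pmf[OF glues \<mu>] by (simp add: reflection_def)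
  ultimately show ?case
    by (intro exI[of _ \<nu>]) (auto simp: frame_def)
qed

section \<open>From entropies to homomorphism densities\<close>

text \<open>Precomposition with the inverse of \<open>f\<close> embeds the homomorphisms, and the
  total numbers of maps agree. This direction carries the bound from the frame to
  \<open>H\<close>.\<close>

lemma hom_density_le_iso:
  assumes iso: "hypergraph_iso f H H'" and H: "finite (verts H)" "edges H \<subseteq> Pow (verts H)"
    and G: "finite (verts G)"
  shows "hom_density H G \<le> hom_density H' G"
proof -
  have bij: "bij_betw f (verts H) (verts H')" and edges: "edges H' = (\<lambda>e. f ` e) ` edges H"
    using iso by (auto simp: hypergraph_iso_def)
  have H': "finite (verts H')"
    using bij H(1) bij_betw_finite by blast
  define g where "g = inv_into (verts H) f"
  have gf: "g (f x) = x" if "x \<in> verts H" for x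
    using bij that by (simp add: g_def bij_betw_inv_into_left)
  have g: "g y \<in> verts H" if "y \<in> verts H'" for y
    using bij that by (simp add: g_def bij_betwE[OF bij_betw_inv_into])
  have f: "f x \<in> verts H'" if "x \<in> verts H" for x
    using bij that by (simp add: bij_betwE)
  let ?\<Phi> = "\<lambda>\<phi>. restrict (\<phi> \<circ> g) (verts H')"
  have "card {\<phi>. is_hom H G \<phi>} \<le> card {\<phi>. is_hom H' G \<phi>}"
  proof (rule card_inj_on_le[of ?\<Phi>])
    show "inj_on ?\<Phi> {\<phi>. is_hom H G \<phi>}"
    proof (rule inj_onI)
      fix \<phi> \<psi> assume hom: "\<phi> \<in> {\<phi>. is_hom H G \<phi>}" "\<psi> \<in> {\<phi>. is_hom H G \<phi>}"
        and eq: "?\<Phi> \<phi> = ?\<Phi> \<psi>"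
      show "\<phi> = \<psi>"
      proof (rule PiE_ext[of _ "verts H" "\<lambda>_. verts G"])
        show "\<phi> x = \<psi> x" if "x \<in> verts H" for x
          using fun_cong[OF eq, of "f x"] that f gf by simp
      qed (use hom in \<open>auto simp: is_hom_def\<close>)
    qed
    show "?\<Phi> ` {\<phi>. is_hom H G \<phi>} \<subseteq> {\<phi>. is_hom H' G \<phi>}"
    proof clarify
      fix \<phi> assume \<phi>: "is_hom H G \<phi>"
      have "?\<Phi> \<phi> ` f ` e = \<phi> ` e" if "e \<in> edges H" for e
        unfolding image_image using that H(2) f gf by (intro image_cong) (auto simp: subset_iff)
      moreover have "?\<Phi> \<phi> \<in> verts H' \<rightarrow>\<^sub>E verts G"
        using \<phi> g by (auto simp: is_hom_def)
      ultimately show "is_hom H' G (?\<Phi> \<phi>)"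
        using \<phi> by (auto simp: is_hom_def edges)
    qed
    show "finite {\<phi>. is_hom H' G \<phi>}"
      using H' G by (rule finite_homs)
  qed
  moreover have "card (verts H \<rightarrow>\<^sub>E verts G) = card (verts H' \<rightarrow>\<^sub>E verts G)"
    using H(1) H' bij_betw_same_card[OF bij] by (simp add: card_funcsetE)
  ultimately show ?thesis
    by (simp add: hom_density_eq_card H(1) H' G divide_right_mono)
qed

lemma weakly_thick_complex_hom_density:
  assumes M: "reflection_complex k M" and thick: "weakly_thick_complex k M"
    and G: "finite (verts G)"
  shows "hom_density (single_edge k) G ^ card (edges (frame k M)) \<le> hom_density (frame k M) G"
proof -
  let ?V = "verts M" and ?E = "edges (frame k M)"
  define n where "n = card (verts G)"
  define N where "N = card {f. is_hom (single_edge k) G f}"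
  define h where "h = card {f. is_hom (frame k M) G f}"
  have bM: "is_b_hypergraph M"
    using M by (rule reflection_complex_is_b_hypergraph)
  then have V: "finite ?V" "edges M \<subseteq> Pow ?V"
    and B: "\<And>A B. (A, B) \<in> brel M \<Longrightarrow> A \<subseteq> ?V \<and> B \<subseteq> ?V"
    by (auto simp: is_b_hypergraph_def)
  have finE: "finite ?E"
    using V finite_subset by (fastforce simp: frame_def)
  have single: "hom_density (single_edge k) G = real N / real n ^ k"
    using G by (simp add: hom_density_eq_card single_edge_def card_funcsetE n_def N_def)
  have frame: "hom_density (frame k M) G = real h / real n ^ card ?V"
    using G V by (simp add: hom_density_eq_card frame_def card_funcsetE n_def h_def)
  show ?thesis
  proof (cases "N = 0")
    \<comment> \<open>The left side is zero, as the frame has at least one edge.\<close>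
    case True
    then show ?thesis
      using reflection_complex_frame_nonempty[OF M] finE
      by (simp add: single frame card_gt_0_iff zero_power)
  next
    case False
    then have homs: "{f. is_hom (single_edge k) G f} \<noteq> {}"
      unfolding N_def by (metis card.empty)
    obtain \<mu> where \<mu>: "set_pmf \<mu> \<subseteq> ?V \<rightarrow>\<^sub>E verts G"
      and marg: "\<And>K h. K \<in> ?E \<Longrightarrow> cyl \<mu> K h \<noteq> 0 \<Longrightarrow> cyl \<mu> K h = 1 / real N \<and> h ` K \<in> edges G"
      and indep: "\<And>A B h. (A, B) \<in> brel M \<Longrightarrow>
        cyl \<mu> (A \<union> B) h * cyl \<mu> (A \<inter> B) h = cyl \<mu> A h * cyl \<mu> B h"
      using reflection_complex_pmf[OF M G homs] unfolding N_def by auto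
    note ctxt = \<mu> V(1) G n_def
    have supp: "set_pmf \<mu> \<subseteq> {f. is_hom (frame k M) G f}"
    proof
      fix f assume f: "f \<in> set_pmf \<mu>"
      then have "f ` K \<in> edges G" if "K \<in> ?E" for K
        using marg[OF that, of f] cyl_pos[OF f, of K] by simp
      then show "f \<in> {f. is_hom (frame k M) G f}"
        using f \<mu> by (simp add: is_hom_def frame_def subset_iff)
    qed
    have fin: "finite {f. is_hom (frame k M) G f}"
      using V G by (intro finite_homs) (simp_all add: frame_def)
    have pos: "0 < real n ^ card ?V" "0 < real n ^ k" "0 < real h" "0 < real N"
    proof -
      obtain K where "K \<in> ?E"
        using reflection_complex_frame_nonempty[OF M] by blast
      then have "K \<subseteq> ?V" "card K = k"
        using V by (auto simp: frame_def)
      then show "0 < real n ^ k"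
        using n_power_pos[OF ctxt, of K] by simp
      show "0 < real n ^ card ?V"
        using n_power_pos[OF ctxt, of ?V] by simp
      show "0 < real h"
        using supp fin set_pmf_not_empty[of \<mu>] by (auto simp: h_def card_gt_0_iff)
      show "0 < real N"
        using False by simp
    qed
    have "ln (real n ^ card ?V / real h) \<le> rel_entropy n \<mu> ?V"
      unfolding h_def by (rule rel_entropy_support_ge[OF ctxt supp fin])
    also have "\<dots> \<le> (\<Sum>e\<in>?E. rel_entropy n \<mu> e)"
    proof (rule weakly_thick_complex_le[OF bM thick])
      show "rel_entropy n \<mu> {} = 0"
        by (rule rel_entropy_empty[OF ctxt])
      show "0 \<le> rel_entropy n \<mu> A" if "A \<subseteq> ?V" for A
        by (rule rel_entropy_nonneg[OF ctxt that])
      show "0 \<le> rel_entropy n \<mu> (A \<union> B) - rel_entropy n \<mu> A - rel_entropy n \<mu> B + rel_entropy n \<mu> (A \<inter> B)"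
        if "A \<subseteq> ?V" "B \<subseteq> ?V" for A B
        by (rule rel_entropy_supermodular[OF ctxt that])
      show "rel_entropy n \<mu> (A \<union> B) - rel_entropy n \<mu> A - rel_entropy n \<mu> B + rel_entropy n \<mu> (A \<inter> B) = 0"
        if "(A, B) \<in> brel M" for A B
        using B[OF that] indep[OF that] by (intro rel_entropy_cond_indep[OF ctxt]) auto
    qed
    also have "\<dots> = (\<Sum>e\<in>?E. ln (real n ^ k / real N))"
    proof (rule sum.cong)
      fix e assume e: "e \<in> ?E"
      have "rel_entropy n \<mu> e = ln (real n ^ card e * (1 / real N))"
        using marg[OF e] cyl_pos[of _ \<mu> e] by (intro rel_entropy_uniform[OF ctxt]) force
      then show "rel_entropy n \<mu> e = ln (real n ^ k / real N)"
        using e by (simp add: frame_def)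
    qed simp
    also have "\<dots> = ln ((real n ^ k / real N) ^ card ?E)"
      using pos by (simp add: ln_realpow)
    finally have "real n ^ card ?V / real h \<le> (real n ^ k / real N) ^ card ?E"
      using pos by (subst (asm) ln_le_cancel_iff) simp_all
    \<comment> \<open>The two sides were reciprocals of densities, so inverting gives the
      claim.\<close>
    then have "inverse ((real n ^ k / real N) ^ card ?E) \<le> inverse (real n ^ card ?V / real h)"
      using pos by (intro le_imp_inverse_le) simp_all
    then show ?thesis
      by (simp add: single frame power_inverse[symmetric])
  qed
qed

theorem theorem9p1:
  fixes k :: nat and H :: "'a hypergraph" and G :: "'b hypergraph"
  assumes "uniform_hypergraph k H" and "weakly_thick k H"
    and "uniform_hypergraph k G"
  shows "hom_density H G \<ge> hom_density (single_edge k) G ^ card (edges H)"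
proof -
  obtain M f where M: "reflection_complex k M" "weakly_thick_complex k M"
    and iso: "hypergraph_iso f (frame k M) H"
    using assms(2) by (auto simp: weakly_thick_def)
  have G: "finite (verts G)"
    using assms(3) by (simp add: uniform_hypergraph_def)
  have V: "finite (verts (frame k M))" "edges (frame k M) \<subseteq> Pow (verts (frame k M))"
    using reflection_complex_is_b_hypergraph[OF M(1)] by (auto simp: is_b_hypergraph_def frame_def)
  \<comment> \<open>Distinct edges have distinct images, so the exponent is the same for
    \<open>H\<close> and the frame.\<close>
  have "inj_on (image f) (edges (frame k M))"
    using iso V(2) inj_on_image_Pow inj_on_subset
    unfolding hypergraph_iso_def bij_betw_def by metis
  then have "card (edges H) = card (edges (frame k M))"
    using iso by (simp add: hypergraph_iso_def card_image)
  then show ?thesis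
    using weakly_thick_complex_hom_density[OF M G] hom_density_le_iso[OF iso V G] by simp
qed

end
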